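(* Let $Q_n(\mathbf a,\mathbf b,\mathbf c,\mathbf d,\mathbf e)$ be the polynomial in the indeterminates $a_{\ell,\ell'},b_{\ell,\ell'},c_{\ell,\ell'},d_{\ell,\ell'},e_\ell$ ($\ell,\ell'\ge0$) defined in the context by means of cyclic statistics. Then $$Q_n(\mathbf a,\mathbf b,\mathbf c,\mathbf d,\mathbf e)=\sum_{\sigma\in\mathfrak S_n}\ \prod_{i\in\mathrm{Val}(\sigma)}a_{(31\text{-}2)(i,\sigma),\,(2\text{-}31)(i,\sigma)}\prod_{i\in\mathrm{Peak}(\sigma)}b_{(31\text{-}2)(i,\sigma),\,(2\text{-}31)(i,\sigma)}\prod_{i\in\mathrm{Ddes}(\sigma)}c_{(31\text{-}2)(i,\sigma),\,(2\text{-}31)(i,\sigma)}$$ $$\times\prod_{i\in\mathrm{Dasc}(\sigma)\setminus\mathrm{Fmax}(\sigma)}d_{(31\text{-}2)(i,\sigma)-1,\,(2\text{-}31)(i,\sigma)}\prod_{i\in\mathrm{Fmax}(\sigma)}e_{(2\text{-}31)(i,\sigma)}.$$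
   Context: $\mathfrak S_n$ is the set of permutations of $[n]=\{1,\dots,n\}$. Cyclic side. For $\sigma\in\mathfrak S_n$, $\mathrm{Cpeak}$, $\mathrm{Cval}$, $\mathrm{Cdrise}$, $\mathrm{Cdfall}$, $\mathrm{Fix}$ are the sets of $i\in[n]$ with, respectively, $\sigma^{-1}(i)<i>\sigma(i)$; $\sigma^{-1}(i)>i<\sigma(i)$; $\sigma^{-1}(i)<i<\sigma(i)$; $\sigma^{-1}(i)>i>\sigma(i)$; $\sigma(i)=i$. Put $\mathrm{ucross}(j,\sigma)=\#\{i<j<k<l: k=\sigma(i),\ l=\sigma(j)\}$, $\mathrm{unest}(j,\sigma)=\#\{i<j<k<l: k=\sigma(j),\ l=\sigma(i)\}$, $\mathrm{lcross}(k,\sigma)=\#\{i<j<k<l: i=\sigma(k),\ j=\sigma(l)\}$, $\mathrm{lnest}(k,\sigma)=\#\{i<j<k<l: i=\sigma(l),\ j=\sigma(k)\}$, and for a fixed point $j$, $\mathrm{lev}(j,\sigma)=\#\{i<j<l: l=\sigma(i)\}$. Then $$Q_n(\mathbf a,\mathbf b,\mathbf c,\mathbf d,\mathbf e)=\sum_{\sigma\in\mathfrak S_n}\prod_{i\in\mathrm{Cval}}a_{\mathrm{ucross}(i,\sigma),\mathrm{unest}(i,\sigma)}\prod_{i\in\mathrm{Cpeak}}b_{\mathrm{lcross}(i,\sigma),\mathrm{lnest}(i,\sigma)}\prod_{i\in\mathrm{Cdfall}}c_{\mathrm{lcross}(i,\sigma),\mathrm{lnest}(i,\sigma)}\prod_{i\in\mathrm{Cdrise}}d_{\mathrm{ucross}(i,\sigma),\mathrm{unest}(i,\sigma)}\prod_{i\in\mathrm{Fix}}e_{\mathrm{lev}(i,\sigma)}.$$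 Linear side. With the convention $\sigma(0)=0$, $\sigma(n+1)=n+1$, a value $\sigma(i)$ ($1\le i\le n$) is a double ascent if $\sigma(i-1)<\sigma(i)<\sigma(i+1)$, a double descent if $\sigma(i-1)>\sigma(i)>\sigma(i+1)$, a peak if $\sigma(i-1)<\sigma(i)>\sigma(i+1)$, a valley if $\sigma(i-1)>\sigma(i)<\sigma(i+1)$; a foremaximum is a double ascent $\sigma(i)$ with $\sigma(j)<\sigma(i)$ for all $j<i$. $\mathrm{Dasc},\mathrm{Ddes},\mathrm{Peak},\mathrm{Val},\mathrm{Fmax}$ denote the corresponding sets of values. For a value $i\in[n]$, $(31\text{-}2)(i,\sigma)=\#\{j: 1<j<\sigma^{-1}(i),\ \sigma(j)<i<\sigma(j-1)\}$, $(2\text{-}31)(i,\sigma)=\#\{j: \sigma^{-1}(i)<j<n,\ \sigma(j+1)<i<\sigma(j)\}$. *)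

theory Defs
  imports "HOL-Library.Poly_Mapping" "HOL-Combinatorics.Permutations"
begin

(* A permutation of [n] is a function s with "s permutes {1..n}". Such an s fixes every
   other natural number, so the boundary convention s(0) = 0, s(n+1) = n+1 of the linear
   statistics holds automatically. *)

definition Cpeak :: "nat \<Rightarrow> (nat \<Rightarrow> nat) \<Rightarrow> nat set" where
  "Cpeak n \<sigma> = {i \<in> {1..n}. inv \<sigma> i < i \<and> i > \<sigma> i}"

definition Cval :: "nat \<Rightarrow> (nat \<Rightarrow> nat) \<Rightarrow> nat set" where
  "Cval n \<sigma> = {i \<in> {1..n}. inv \<sigma> i > i \<and> i < \<sigma> i}"

definition Cdrise :: "nat \<Rightarrow> (nat \<Rightarrow> nat) \<Rightarrow> nat set" where
  "Cdrise n \<sigma> = {i \<in> {1..n}. inv \<sigma> i < i \<and> i < \<sigma> i}"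

definition Cdfall :: "nat \<Rightarrow> (nat \<Rightarrow> nat) \<Rightarrow> nat set" where
  "Cdfall n \<sigma> = {i \<in> {1..n}. inv \<sigma> i > i \<and> i > \<sigma> i}"

definition Fix :: "nat \<Rightarrow> (nat \<Rightarrow> nat) \<Rightarrow> nat set" where
  "Fix n \<sigma> = {i \<in> {1..n}. \<sigma> i = i}"

definition ucross :: "nat \<Rightarrow> nat \<Rightarrow> (nat \<Rightarrow> nat) \<Rightarrow> nat" where
  "ucross n j \<sigma> = card {(i, k, l). {i, k, l} \<subseteq> {1..n} \<and>
     i < j \<and> j < k \<and> k < l \<and> k = \<sigma> i \<and> l = \<sigma> j}"

definition unest :: "nat \<Rightarrow> nat \<Rightarrow> (nat \<Rightarrow> nat) \<Rightarrow> nat" where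
  "unest n j \<sigma> = card {(i, k, l). {i, k, l} \<subseteq> {1..n} \<and>
     i < j \<and> j < k \<and> k < l \<and> k = \<sigma> j \<and> l = \<sigma> i}"

definition lcross :: "nat \<Rightarrow> nat \<Rightarrow> (nat \<Rightarrow> nat) \<Rightarrow> nat" where
  "lcross n k \<sigma> = card {(i, j, l). {i, j, l} \<subseteq> {1..n} \<and>
     i < j \<and> j < k \<and> k < l \<and> i = \<sigma> k \<and> j = \<sigma> l}"

definition lnest :: "nat \<Rightarrow> nat \<Rightarrow> (nat \<Rightarrow> nat) \<Rightarrow> nat" where
  "lnest n k \<sigma> = card {(i, j, l). {i, j, l} \<subseteq> {1..n} \<and>
     i < j \<and> j < k \<and> k < l \<and> i = \<sigma> l \<and> j = \<sigma> k}"

definition lev :: "nat \<Rightarrow> nat \<Rightarrow> (nat \<Rightarrow> nat) \<Rightarrow> nat" where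
  "lev n j \<sigma> = card {(i, l). {i, l} \<subseteq> {1..n} \<and> i < j \<and> j < l \<and> l = \<sigma> i}"

definition Qpoly ::
  "nat \<Rightarrow> (nat \<Rightarrow> nat \<Rightarrow> 'r) \<Rightarrow> (nat \<Rightarrow> nat \<Rightarrow> 'r) \<Rightarrow> (nat \<Rightarrow> nat \<Rightarrow> 'r) \<Rightarrow>
   (nat \<Rightarrow> nat \<Rightarrow> 'r) \<Rightarrow> (nat \<Rightarrow> 'r) \<Rightarrow> 'r::comm_ring_1" where
  "Qpoly n a b c d e = (\<Sum>\<sigma> | \<sigma> permutes {1..n}.
      (\<Prod>i\<in>Cval n \<sigma>. a (ucross n i \<sigma>) (unest n i \<sigma>)) *
      (\<Prod>i\<in>Cpeak n \<sigma>. b (lcross n i \<sigma>) (lnest n i \<sigma>)) *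
      (\<Prod>i\<in>Cdfall n \<sigma>. c (lcross n i \<sigma>) (lnest n i \<sigma>)) *
      (\<Prod>i\<in>Cdrise n \<sigma>. d (ucross n i \<sigma>) (unest n i \<sigma>)) *
      (\<Prod>i\<in>Fix n \<sigma>. e (lev n i \<sigma>)))"

(* Dasc, Ddes, Peak, Val and Fmax are sets of values \<sigma> p, where p is a position. *)

definition Dasc :: "nat \<Rightarrow> (nat \<Rightarrow> nat) \<Rightarrow> nat set" where
  "Dasc n \<sigma> = {\<sigma> p | p. p \<in> {1..n} \<and> \<sigma> (p - 1) < \<sigma> p \<and> \<sigma> p < \<sigma> (p + 1)}"

definition Ddes :: "nat \<Rightarrow> (nat \<Rightarrow> nat) \<Rightarrow> nat set" where
  "Ddes n \<sigma> = {\<sigma> p | p. p \<in> {1..n} \<and> \<sigma> (p - 1) > \<sigma> p \<and> \<sigma> p > \<sigma> (p + 1)}"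

definition Peak :: "nat \<Rightarrow> (nat \<Rightarrow> nat) \<Rightarrow> nat set" where
  "Peak n \<sigma> = {\<sigma> p | p. p \<in> {1..n} \<and> \<sigma> (p - 1) < \<sigma> p \<and> \<sigma> p > \<sigma> (p + 1)}"

definition Val :: "nat \<Rightarrow> (nat \<Rightarrow> nat) \<Rightarrow> nat set" where
  "Val n \<sigma> = {\<sigma> p | p. p \<in> {1..n} \<and> \<sigma> (p - 1) > \<sigma> p \<and> \<sigma> p < \<sigma> (p + 1)}"

definition Fmax :: "nat \<Rightarrow> (nat \<Rightarrow> nat) \<Rightarrow> nat set" where
  "Fmax n \<sigma> = {\<sigma> p | p. p \<in> {1..n} \<and> \<sigma> (p - 1) < \<sigma> p \<and> \<sigma> p < \<sigma> (p + 1) \<and>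
     (\<forall>j\<in>{1..<p}. \<sigma> j < \<sigma> p)}"

(* The statistics (31-2)(i,\<sigma>) and (2-31)(i,\<sigma>); i is a value. *)

definition pat31_2 :: "nat \<Rightarrow> (nat \<Rightarrow> nat) \<Rightarrow> nat" where
  "pat31_2 i \<sigma> = card {j. 1 < j \<and> j < inv \<sigma> i \<and> \<sigma> j < i \<and> i < \<sigma> (j - 1)}"

definition pat2_31 :: "nat \<Rightarrow> nat \<Rightarrow> (nat \<Rightarrow> nat) \<Rightarrow> nat" where
  "pat2_31 n i \<sigma> = card {j. inv \<sigma> i < j \<and> j < n \<and> \<sigma> (j + 1) < i \<and> i < \<sigma> j}"

(* The ring of polynomials with integer coefficients in the indeterminates
   a_{l,l'}, b_{l,l'}, c_{l,l'}, d_{l,l'}, e_l: a monomial is a finitely supported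
   exponent map, and a polynomial a finitely supported map from monomials to
   coefficients, with convolution as multiplication. *)

datatype indet =
  Ind_a nat nat | Ind_b nat nat | Ind_c nat nat | Ind_d nat nat | Ind_e nat

type_synonym ind_poly = "(indet \<Rightarrow>\<^sub>0 nat) \<Rightarrow>\<^sub>0 int"

definition PVar :: "indet \<Rightarrow> ind_poly" where
  "PVar x = Poly_Mapping.single (Poly_Mapping.single x 1) 1"

abbreviation \<a> :: "nat \<Rightarrow> nat \<Rightarrow> ind_poly" where "\<a> l l' \<equiv> PVar (Ind_a l l')"
abbreviation \<b> :: "nat \<Rightarrow> nat \<Rightarrow> ind_poly" where "\<b> l l' \<equiv> PVar (Ind_b l l')"
abbreviation \<c> :: "nat \<Rightarrow> nat \<Rightarrow> ind_poly" where "\<c> l l' \<equiv> PVar (Ind_c l l')"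
abbreviation \<d> :: "nat \<Rightarrow> nat \<Rightarrow> ind_poly" where "\<d> l l' \<equiv> PVar (Ind_d l l')"
abbreviation \<e> :: "nat \<Rightarrow> ind_poly" where "\<e> l \<equiv> PVar (Ind_e l)"

end

theory Submission
  imports Defs
begin

text \<open>Both sides are generating functions of the same labelled Motzkin paths (Laguerre histories).
  Reading the values \<open>i = 1, \<dots>, n\<close> in order, a permutation gives a path by its cyclic type or by
  its linear type at \<open>i\<close>, the height being the number of open arcs or the number of descents
  straddling \<open>i\<close>, and a label by its crossing number or by \<open>(31-2)(i)\<close>; the height then
  determines the nesting number or \<open>(2-31)(i)\<close>. Both maps from permutations to histories are
  injective, and there are exactly \<open>n!\<close> histories, so both are weight-preserving bijections.\<close>

section \<open>Laguerre histories\<close>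

text \<open>Neither encoding is inverted: surjectivity comes from the count alone, so each side only
  has to supply heights, labels and a proof that the labels determine the permutation. The delicate
  step is the one with both bits false, which has \<open>h + 1\<close> labels at height
  \<open>h\<close>. On the cyclic side a double rise can realise only \<open>h\<close> crossing
  numbers, since the arc ending there is counted in the height but takes part in no crossing or
  nesting counted there; the spare label goes to the fixed point. On the linear side the label 0 at
  such a step means that no larger value precedes, which singles out the foremaxima. The two
  injectivity proofs are of different nature. Cyclic arcs are recovered one by one, a crossing
  number being the rank of a target among those still available. On the linear side values are
  inserted in increasing order, and the relative order of the smaller values is not enough to place
  the next one: it must also be known which of them are adjacent in the final word.\<close>

text \<open>A history is stored with its last step first. In a step \<open>(x, y, k)\<close>, \<open>y\<close> lowers the height and \<open>x\<close>
  raises it, so level steps come in two kinds, with \<open>x\<close> and \<open>y\<close> both true or both false.\<close>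

fun height :: "(bool \<times> bool \<times> nat) list \<Rightarrow> nat" where
  "height [] = 0"
| "height ((x, y, k) # w) = height w - of_bool y + of_bool x"

text \<open>The condition \<open>of_bool y \<le> height w\<close> keeps the natural subtraction in
  \<open>height\<close> from truncating. At height \<open>h\<close> it leaves \<open>h\<close>
  labels if \<open>y\<close> holds and \<open>h + 1\<close> otherwise.\<close>

fun laguerre :: "(bool \<times> bool \<times> nat) list \<Rightarrow> bool" where
  "laguerre [] \<longleftrightarrow> True"
| "laguerre ((x, y, k) # w) \<longleftrightarrow> laguerre w \<and> of_bool y \<le> height w \<and> k \<le> height w - of_bool y"

fun weight :: "(nat \<Rightarrow> bool \<times> bool \<times> nat \<Rightarrow> 'r::comm_monoid_mult) \<Rightarrow> (bool \<times> bool \<times> nat) list \<Rightarrow> 'r" where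
  "weight W [] = 1"
| "weight W (l # w) = W (height w) l * weight W w"

primrec history :: "nat \<Rightarrow> (nat \<Rightarrow> bool \<times> bool \<times> nat) \<Rightarrow> (bool \<times> bool \<times> nat) list" where
  "history 0 f = []"
| "history (Suc n) f = f (Suc n) # history n f"

definition histories :: "nat \<Rightarrow> nat \<Rightarrow> (bool \<times> bool \<times> nat) list set" where
  "histories n h = {w. length w = n \<and> laguerre w \<and> height w = h}"

definition laguerre_step :: "nat \<Rightarrow> bool \<times> bool \<times> nat \<Rightarrow> nat \<Rightarrow> bool" where
  "laguerre_step h l h' \<longleftrightarrow> (case l of (x, y, k) \<Rightarrow>
     of_bool y \<le> h \<and> k \<le> h - of_bool y \<and> h' = h - of_bool y + of_bool x)"

section \<open>Counting histories by length and final height\<close>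

lemma histories_0: "histories 0 h = (if h = 0 then {[]} else {})"
  by (auto simp: histories_def)

text \<open>The union splits by the type of the last step. A step with \<open>x\<close> true always
  ends at positive height, hence the empty cases for \<open>h = 0\<close>.\<close>

lemma histories_Suc:
  "histories (Suc n) h =
     (\<lambda>(w, k). (False, False, k) # w) ` (histories n h \<times> {..h})
   \<union> (\<lambda>(w, k). (False, True, k) # w) ` (histories n (Suc h) \<times> {..h})
   \<union> (\<lambda>(w, k). (True, True, k) # w) ` (if h = 0 then {} else histories n h \<times> {..h - 1})
   \<union> (\<lambda>(w, k). (True, False, k) # w) ` (if h = 0 then {} else histories n (h - 1) \<times> {..h - 1})"
  (is "?L = ?A \<union> ?B \<union> ?C \<union> ?D")
proof
  show "?L \<subseteq> ?A \<union> ?B \<union> ?C \<union> ?D"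
  proof
    fix v assume v: "v \<in> ?L"
    then obtain x y k w where [simp]: "v = (x, y, k) # w"
      by (cases v) (auto simp: histories_def)
    from v show "v \<in> ?A \<union> ?B \<union> ?C \<union> ?D"
      by (cases x; cases y) (auto simp: histories_def image_iff)
  qed
  show "?A \<union> ?B \<union> ?C \<union> ?D \<subseteq> ?L"
    by (auto simp: histories_def split: if_splits)
qed

lemma finite_histories: "finite (histories n h)"
  by (induction n arbitrary: h) (auto simp: histories_0 histories_Suc)

text \<open>Only \<open>h = 0\<close> is used later, but the recursion links neighbouring heights.
  After division by \<open>fact n\<close>, Pascal's rule turns it into \<open>Suc n * (Suc n choose
  h) = Suc h * (Suc n choose Suc h) + h * (Suc n choose h)\<close>.\<close>

lemma card_histories: "card (histories n h) = fact n * (n choose h)"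
proof (induction n arbitrary: h)
  case 0
  show ?case by (auto simp: histories_0)
next
  case (Suc n)
  have inj: "inj_on (\<lambda>(w, k). (x, y, k) # w) S" for x y :: bool and S :: "((bool \<times> bool \<times> nat) list \<times> nat) set"
    by (auto simp: inj_on_def)
  note fin = finite_histories
  have "card (histories (Suc n) h) =
      card (histories n h \<times> {..h}) + card (histories n (Suc h) \<times> {..h})
      + card (if h = 0 then {} else histories n h \<times> {..h - 1})
      + card (if h = 0 then {} else histories n (h - 1) \<times> {..h - 1})"
    (is "_ = card ?A + card ?B + card ?C + card ?D")
  proof -
    let ?f = "\<lambda>x y (w, k). (x, y, k) # w"
    have "card (histories (Suc n) h) = card (?f False False ` ?A \<union> ?f False True ` ?B \<union> ?f True True ` ?C \<union> ?f True False ` ?D)"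
      unfolding histories_Suc ..
    also have "\<dots> = card (?f False False ` ?A \<union> ?f False True ` ?B \<union> ?f True True ` ?C) + card (?f True False ` ?D)"
      by (rule card_Un_disjoint) (auto simp: fin)
    also have "card (?f False False ` ?A \<union> ?f False True ` ?B \<union> ?f True True ` ?C) =
        card (?f False False ` ?A \<union> ?f False True ` ?B) + card (?f True True ` ?C)"
      by (rule card_Un_disjoint) (auto simp: fin)
    also have "card (?f False False ` ?A \<union> ?f False True ` ?B) = card (?f False False ` ?A) + card (?f False True ` ?B)"
      by (rule card_Un_disjoint) (auto simp: fin)
    finally show ?thesis by (simp only: card_image[OF inj])
  qed
  also have "\<dots> = fact (Suc n) * (Suc n choose h)"
  proof (cases h)
    case 0
    then show ?thesis by (simp add: card_cartesian_product Suc algebra_simps)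
  next
    case (Suc g)
    \<comment> \<open>Absorption, applied to each of the two terms that Pascal's rule produces from
      \<open>Suc n choose Suc g\<close>.\<close>
    have 1: "Suc n * (n choose h) = Suc h * (Suc n choose Suc h)" for h
      using Suc_times_binomial_eq[of n h] by (simp add: mult.commute)
    have "Suc n * (Suc n choose Suc g) = Suc n * (n choose g) + Suc n * (n choose Suc g)"
      by (simp add: algebra_simps)
    also have "\<dots> = Suc g * (Suc n choose Suc g) + Suc (Suc g) * (Suc n choose Suc (Suc g))"
      by (simp only: 1)
    also have "\<dots> = Suc (Suc g) * (n choose Suc g) + Suc (Suc g) * (n choose Suc (Suc g))
       + Suc g * (n choose Suc g) + Suc g * (n choose g)"
      by (simp add: algebra_simps)
    finally have "fact n * (Suc n * (Suc n choose Suc g)) = fact n * (Suc (Suc g) * (n choose Suc g) + Suc (Suc g) * (n choose Suc (Suc g))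
       + Suc g * (n choose Suc g) + Suc g * (n choose g))" by (rule arg_cong)
    then show ?thesis
      by (simp add: card_cartesian_product Suc.IH Suc algebra_simps)
  qed
  finally show ?case .
qed

section \<open>From sums over permutations to sums over histories\<close>

lemma history_in_histories:
  assumes "hh 1 = 0" and "\<And>i. i \<in> {1..n} \<Longrightarrow> laguerre_step (hh i) (f i) (hh (Suc i))"
  shows "history n f \<in> histories n (hh (Suc n))"
  using assms(2)
proof (induction n)
  case 0
  then show ?case using assms(1) by (simp add: histories_def)
next
  case (Suc n)
  from Suc have "history n f \<in> histories n (hh (Suc n))" by auto
  moreover have "laguerre_step (hh (Suc n)) (f (Suc n)) (hh (Suc (Suc n)))" using Suc.prems by auto
  ultimately show ?case
    by (cases "f (Suc n)") (auto simp: histories_def laguerre_step_def)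
qed

lemma weight_history:
  assumes "hh 1 = 0" and "\<And>i. i \<in> {1..n} \<Longrightarrow> laguerre_step (hh i) (f i) (hh (Suc i))"
  shows "weight W (history n f) = (\<Prod>i\<in>{1..n}. W (hh i) (f i))"
  using assms(2)
proof (induction n)
  case (Suc n)
  have "history n f \<in> histories n (hh (Suc n))"
    using Suc.prems by (intro history_in_histories assms(1)) auto
  then have "height (history n f) = hh (Suc n)" by (simp add: histories_def)
  moreover have "weight W (history n f) = (\<Prod>i\<in>{1..n}. W (hh i) (f i))"
    using Suc.prems by (intro Suc.IH) auto
  ultimately show ?case by (simp add: mult.commute)
qed simp

lemma history_eqD: "history n f = history n g \<Longrightarrow> i \<in> {1..n} \<Longrightarrow> f i = g i"
  by (induction n) (auto elim: le_SucE)

text \<open>An injection of the \<open>fact n\<close> permutations into a finite set of the same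
  size is onto. The lemma is stated for arbitrary \<open>hh\<close> and \<open>f\<close> so that
  both sides can use it.\<close>

lemma sum_histories:
  fixes W :: "nat \<Rightarrow> bool \<times> bool \<times> nat \<Rightarrow> 'r::comm_semiring_1"
  assumes "\<And>\<sigma>. \<sigma> permutes {1..n} \<Longrightarrow> hh \<sigma> 1 = 0"
    and "\<And>\<sigma>. \<sigma> permutes {1..n} \<Longrightarrow> hh \<sigma> (Suc n) = 0"
    and step: "\<And>\<sigma> i. \<sigma> permutes {1..n} \<Longrightarrow> i \<in> {1..n} \<Longrightarrow> laguerre_step (hh \<sigma> i) (f \<sigma> i) (hh \<sigma> (Suc i))"
    and inj: "\<And>\<sigma> \<tau>. \<sigma> permutes {1..n} \<Longrightarrow> \<tau> permutes {1..n} \<Longrightarrow>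
      (\<And>i. i \<in> {1..n} \<Longrightarrow> f \<sigma> i = f \<tau> i) \<Longrightarrow> \<sigma> = \<tau>"
  shows "(\<Sum>\<sigma> | \<sigma> permutes {1..n}. \<Prod>i\<in>{1..n}. W (hh \<sigma> i) (f \<sigma> i)) = (\<Sum>w\<in>histories n 0. weight W w)"
proof -
  let ?S = "{\<sigma>. \<sigma> permutes {1..n}}"
  let ?F = "\<lambda>\<sigma>. history n (f \<sigma>)"
  have inj_F: "inj_on ?F ?S"
    by (rule inj_onI) (use inj history_eqD in blast)
  have sub: "?F ` ?S \<subseteq> histories n 0"
  proof (rule image_subsetI)
    fix \<sigma> assume "\<sigma> \<in> ?S"
    then show "?F \<sigma> \<in> histories n 0"
      using history_in_histories[of "hh \<sigma>" n "f \<sigma>"] assms(1,2) step by simp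
  qed
  have "card (?F ` ?S) = card (histories n 0)"
    unfolding card_image[OF inj_F] card_histories by (subst card_permutations) auto
  then have "?F ` ?S = histories n 0"
    using sub finite_histories card_subset_eq by blast
  then have "(\<Sum>w\<in>histories n 0. weight W w) = (\<Sum>\<sigma>\<in>?S. weight W (?F \<sigma>))"
    using sum.reindex[OF inj_F, of "weight W"] by simp
  also have "\<dots> = (\<Sum>\<sigma>\<in>?S. \<Prod>i\<in>{1..n}. W (hh \<sigma> i) (f \<sigma> i))"
    by (rule sum.cong[OF refl], rule weight_history) (use assms(1) step in auto)
  finally show ?thesis by simp
qed

text \<open>Among the steps \<open>(False, False, k)\<close>, the label \<open>k = 0\<close> encodes a fixed point or a foremaximum; this
  is why the first index of \<open>d\<close> is shifted by one.\<close>

definition laguerre_weight ::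
  "(nat \<Rightarrow> nat \<Rightarrow> 'r) \<Rightarrow> (nat \<Rightarrow> nat \<Rightarrow> 'r) \<Rightarrow> (nat \<Rightarrow> nat \<Rightarrow> 'r) \<Rightarrow>
   (nat \<Rightarrow> nat \<Rightarrow> 'r) \<Rightarrow> (nat \<Rightarrow> 'r) \<Rightarrow> nat \<Rightarrow> bool \<times> bool \<times> nat \<Rightarrow> 'r" where
  "laguerre_weight a b c d e h = (\<lambda>(x, y, k).
     if y then (if x then c k (h - 1 - k) else b k (h - 1 - k))
     else if x then a k (h - k)
     else if k = 0 then e h else d (k - 1) (h - k))"

lemma prod_subset:
  assumes "finite S" "A \<subseteq> S"
  shows "prod g A = (\<Prod>i\<in>S. if i \<in> A then g i else 1)"
  using assms prod.inter_restrict[of S g A] by (simp add: Int_absorb1)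

text \<open>Each product is padded with factors 1 to all of \<open>S\<close>. That the classes
  partition \<open>S\<close> is never stated; it enters through the pointwise hypothesis.\<close>

lemma prod_five_subsets:
  assumes "finite S" "A1 \<subseteq> S" "A2 \<subseteq> S" "A3 \<subseteq> S" "A4 \<subseteq> S" "A5 \<subseteq> S"
    and "\<And>i. i \<in> S \<Longrightarrow> (if i \<in> A1 then g1 i else 1) * (if i \<in> A2 then g2 i else 1) *
      (if i \<in> A3 then g3 i else 1) * (if i \<in> A4 then g4 i else 1) * (if i \<in> A5 then g5 i else 1) = f i"
  shows "prod g1 A1 * prod g2 A2 * prod g3 A3 * prod g4 A4 * prod g5 A5 = prod f S"
proof -
  have "prod f S = (\<Prod>i\<in>S. (if i \<in> A1 then g1 i else 1) * (if i \<in> A2 then g2 i else 1) *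
      (if i \<in> A3 then g3 i else 1) * (if i \<in> A4 then g4 i else 1) * (if i \<in> A5 then g5 i else 1))"
    using assms(7) by (intro prod.cong) auto
  then show ?thesis
    by (simp only: prod.distrib assms(2-6)[THEN prod_subset[OF assms(1)]])
qed

section \<open>The cyclic side\<close>

text \<open>These are the upper arcs over the gap between \<open>i - 1\<close> and \<open>i\<close>:
  an arc ending at \<open>i\<close> counts, one starting at \<open>i\<close> does not.\<close>

definition cyc_height :: "(nat \<Rightarrow> nat) \<Rightarrow> nat \<Rightarrow> nat" where
  "cyc_height \<sigma> i = card {j. j < i \<and> i \<le> \<sigma> j}"

text \<open>The summand \<open>of_bool (inv \<sigma> i < i)\<close> pushes double rises to positive
  labels and so reserves 0, with both bits false, for fixed points.\<close>

definition cyc_label :: "nat \<Rightarrow> (nat \<Rightarrow> nat) \<Rightarrow> nat \<Rightarrow> bool \<times> bool \<times> nat" where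
  "cyc_label n \<sigma> i = (inv \<sigma> i > i, \<sigma> i < i,
     if \<sigma> i < i then lcross n i \<sigma>
     else if \<sigma> i = i then 0
     else ucross n i \<sigma> + of_bool (inv \<sigma> i < i))"

context
  fixes n :: nat and \<sigma> :: "nat \<Rightarrow> nat"
  assumes perm: "\<sigma> permutes {1..n}"
begin

lemma perm_inv_simps:
  "\<sigma> (inv \<sigma> i) = i" "inv \<sigma> (\<sigma> i) = i" "inv \<sigma> i = j \<longleftrightarrow> \<sigma> j = i" "\<sigma> i = \<sigma> j \<longleftrightarrow> i = j"
  using permutes_inverses[OF perm] permutes_inv_eq[OF perm] permutes_inj[OF perm]
  by (auto simp: inj_eq)

lemma perm_range: "\<sigma> i \<in> {1..n} \<longleftrightarrow> i \<in> {1..n}" "inv \<sigma> i \<in> {1..n} \<longleftrightarrow> i \<in> {1..n}"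
  using permutes_in_image[OF perm] permutes_in_image[OF permutes_inv[OF perm]] by auto

lemma perm_out: "i \<notin> {1..n} \<Longrightarrow> \<sigma> i = i" "i \<notin> {1..n} \<Longrightarrow> inv \<sigma> i = i"
  using perm permutes_inv[OF perm] by (auto simp: permutes_def)

lemma perm_moved: "\<sigma> i \<noteq> i \<Longrightarrow> i \<in> {1..n} \<and> \<sigma> i \<in> {1..n}"
  using perm_out(1)[of i] perm_range(1)[of i] by blast

lemma ucross_alt: "ucross n j \<sigma> = card {i. i < j \<and> j < \<sigma> i \<and> \<sigma> i < \<sigma> j}"
proof -
  have "{(i, k, l). {i, k, l} \<subseteq> {1..n} \<and> i < j \<and> j < k \<and> k < l \<and> k = \<sigma> i \<and> l = \<sigma> j}
      = (\<lambda>i. (i, \<sigma> i, \<sigma> j)) ` {i. i < j \<and> j < \<sigma> i \<and> \<sigma> i < \<sigma> j}"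
    using perm_moved by (fastforce simp: image_iff)
  then show ?thesis unfolding ucross_def
    by (simp add: card_image inj_on_def)
qed

lemma unest_alt: "unest n j \<sigma> = card {i. i < j \<and> j < \<sigma> j \<and> \<sigma> j < \<sigma> i}"
proof -
  have "{(i, k, l). {i, k, l} \<subseteq> {1..n} \<and> i < j \<and> j < k \<and> k < l \<and> k = \<sigma> j \<and> l = \<sigma> i}
      = (\<lambda>i. (i, \<sigma> j, \<sigma> i)) ` {i. i < j \<and> j < \<sigma> j \<and> \<sigma> j < \<sigma> i}"
    using perm_moved by (fastforce simp: image_iff)
  then show ?thesis unfolding unest_def
    by (simp add: card_image inj_on_def)
qed

lemma lcross_alt: "lcross n k \<sigma> = card {j. \<sigma> k < j \<and> j < k \<and> k < inv \<sigma> j}"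
proof -
  have "{(i, j, l). {i, j, l} \<subseteq> {1..n} \<and> i < j \<and> j < k \<and> k < l \<and> i = \<sigma> k \<and> j = \<sigma> l}
      = (\<lambda>j. (\<sigma> k, j, inv \<sigma> j)) ` {j. \<sigma> k < j \<and> j < k \<and> k < inv \<sigma> j}"
    using perm_moved[of k] perm_moved[of "inv \<sigma> _"] by (auto simp: image_iff perm_inv_simps)
  then show ?thesis unfolding lcross_def
    by (simp add: card_image inj_on_def)
qed

lemma lnest_alt: "lnest n k \<sigma> = card {i. i < \<sigma> k \<and> \<sigma> k < k \<and> k < inv \<sigma> i}"
proof -
  have "{(i, j, l). {i, j, l} \<subseteq> {1..n} \<and> i < j \<and> j < k \<and> k < l \<and> i = \<sigma> l \<and> j = \<sigma> k}
      = (\<lambda>i. (i, \<sigma> k, inv \<sigma> i)) ` {i. i < \<sigma> k \<and> \<sigma> k < k \<and> k < inv \<sigma> i}"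
    using perm_moved[of k] perm_moved[of "inv \<sigma> _"] by (auto simp: image_iff perm_inv_simps)
  then show ?thesis unfolding lnest_def
    by (simp add: card_image inj_on_def)
qed

lemma lev_alt: "lev n j \<sigma> = card {i. i < j \<and> j < \<sigma> i}"
proof -
  have "{(i, l). {i, l} \<subseteq> {1..n} \<and> i < j \<and> j < l \<and> l = \<sigma> i}
      = (\<lambda>i. (i, \<sigma> i)) ` {i. i < j \<and> j < \<sigma> i}"
    using perm_moved by (fastforce simp: image_iff)
  then show ?thesis unfolding lev_def
    by (simp add: card_image inj_on_def)
qed

lemma cyc_height_split: "cyc_height \<sigma> i = card {j. j < i \<and> i < \<sigma> j} + of_bool (inv \<sigma> i < i)"
proof -
  have "{j. j < i \<and> i \<le> \<sigma> j} = {j. j < i \<and> i < \<sigma> j} \<union> {j. j = inv \<sigma> i \<and> j < i}"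
    by (auto simp: perm_inv_simps le_less)
  moreover have "card ({j. j < i \<and> i < \<sigma> j} \<union> {j. j = inv \<sigma> i \<and> j < i})
      = card {j. j < i \<and> i < \<sigma> j} + card {j. j = inv \<sigma> i \<and> j < i}"
    by (rule card_Un_disjoint) (auto simp: perm_inv_simps)
  moreover have "card {j. j = inv \<sigma> i \<and> j < i} = of_bool (inv \<sigma> i < i)"
    by (auto simp: of_bool_def conj_commute cong: conj_cong)
  ultimately show ?thesis by (simp add: cyc_height_def)
qed

lemma cyc_height_Suc: "cyc_height \<sigma> (Suc i) = card {j. j < i \<and> i < \<sigma> j} + of_bool (i < \<sigma> i)"
proof -
  have "{j. j < Suc i \<and> Suc i \<le> \<sigma> j} = {j. j < i \<and> i < \<sigma> j} \<union> {j. j = i \<and> i < \<sigma> i}"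
    by (auto simp: less_Suc_eq)
  moreover have "card ({j. j < i \<and> i < \<sigma> j} \<union> {j. j = i \<and> i < \<sigma> i})
      = card {j. j < i \<and> i < \<sigma> j} + card {j. j = i \<and> i < \<sigma> i}"
    by (rule card_Un_disjoint) auto
  moreover have "card {j. j = i \<and> i < \<sigma> i} = of_bool (i < \<sigma> i)"
    by (auto simp: of_bool_def)
  ultimately show ?thesis by (simp add: cyc_height_def)
qed

text \<open>A permutation sends as many elements out of \<open>{..<i}\<close> as into it. This is
  needed because \<open>lcross\<close> and \<open>lnest\<close> count lower arcs while the height
  counts upper ones.\<close>

lemma cyc_height_lower: "cyc_height \<sigma> i = card {t. t < i \<and> i \<le> inv \<sigma> t}"
proof -
  let ?A = "{j. j < i \<and> i \<le> \<sigma> j}" and ?B = "{t. t < i \<and> i \<le> inv \<sigma> t}"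
  let ?C = "{j. j < i \<and> \<sigma> j < i}"
  have "?A \<union> ?C = {..<i}" "?A \<inter> ?C = {}" by auto
  then have 1: "card ?A + card ?C = card {..<i}"
    using card_Un_disjoint[of ?A ?C] by simp
  have "\<sigma> ` ?C = {t. t < i \<and> inv \<sigma> t < i}"
  proof (intro set_eqI iffI)
    fix t assume "t \<in> {t. t < i \<and> inv \<sigma> t < i}"
    then show "t \<in> \<sigma> ` ?C"
      using perm_inv_simps(1)[of t] by (intro image_eqI[of _ _ "inv \<sigma> t"]) auto
  qed (auto simp: perm_inv_simps(2))
  then have "\<sigma> ` ?C \<union> ?B = {..<i}" "\<sigma> ` ?C \<inter> ?B = {}" by auto
  then have "card (\<sigma> ` ?C) + card ?B = card {..<i}"
    using card_Un_disjoint[of "\<sigma> ` ?C" ?B] by simp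
  moreover have "card (\<sigma> ` ?C) = card ?C"
    by (rule card_image) (simp add: inj_on_def perm_inv_simps(4))
  ultimately show ?thesis using 1 by (simp add: cyc_height_def)
qed

text \<open>An upper arc passing over \<open>j\<close> ends either before \<open>\<sigma> j\<close>
  (a crossing) or after it (a nesting). The last summand is the arc that ends at
  \<open>j\<close>.\<close>

lemma ucross_unest:
  assumes "j < \<sigma> j"
  shows "cyc_height \<sigma> j = ucross n j \<sigma> + unest n j \<sigma> + of_bool (inv \<sigma> j < j)"
proof -
  have "{i. i < j \<and> j < \<sigma> i} = {i. i < j \<and> j < \<sigma> i \<and> \<sigma> i < \<sigma> j} \<union> {i. i < j \<and> j < \<sigma> j \<and> \<sigma> j < \<sigma> i}"
    using assms linorder_less_linear[of "\<sigma> j" "\<sigma> _"] by (auto simp: perm_inv_simps)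
  moreover have "card ({i. i < j \<and> j < \<sigma> i \<and> \<sigma> i < \<sigma> j} \<union> {i. i < j \<and> j < \<sigma> j \<and> \<sigma> j < \<sigma> i})
      = ucross n j \<sigma> + unest n j \<sigma>"
    unfolding ucross_alt unest_alt by (rule card_Un_disjoint) auto
  ultimately show ?thesis by (simp add: cyc_height_split)
qed

text \<open>Among the lower arcs over the gap before \<open>k\<close>, the one starting at
  \<open>k\<close> accounts for \<open>Suc\<close>; the others land above \<open>\<sigma> k\<close>
  (crossings) or below it (nestings).\<close>

lemma lcross_lnest:
  assumes "\<sigma> k < k"
  shows "cyc_height \<sigma> k = Suc (lcross n k \<sigma> + lnest n k \<sigma>)"
proof -
  have "{t. t < k \<and> k \<le> inv \<sigma> t} =
      insert (\<sigma> k) ({j. \<sigma> k < j \<and> j < k \<and> k < inv \<sigma> j} \<union> {i. i < \<sigma> k \<and> \<sigma> k < k \<and> k < inv \<sigma> i})"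
    (is "_ = insert _ (?A \<union> ?B)")
    using assms by (auto simp: perm_inv_simps le_less neq_iff[symmetric])
  moreover have "card (?A \<union> ?B) = lcross n k \<sigma> + lnest n k \<sigma>"
    unfolding lcross_alt lnest_alt by (rule card_Un_disjoint) auto
  moreover have "finite (?A \<union> ?B)" "\<sigma> k \<notin> ?A \<union> ?B" by auto
  ultimately show ?thesis unfolding cyc_height_lower
    by simp
qed

lemma cyc_step: "laguerre_step (cyc_height \<sigma> i) (cyc_label n \<sigma> i) (cyc_height \<sigma> (Suc i))"
proof -
  consider "\<sigma> i < i" | "\<sigma> i = i" | "i < \<sigma> i" by linarith
  then show ?thesis
  proof cases
    case 1
    then have "inv \<sigma> i \<noteq> i" by (simp add: perm_inv_simps)
    then show ?thesis
      using 1 lcross_lnest[OF 1] cyc_height_split[of i] cyc_height_Suc[of i]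
      by (auto simp: laguerre_step_def cyc_label_def of_bool_def split: if_splits)
  next
    case 2
    then have "inv \<sigma> i = i" by (simp add: perm_inv_simps)
    then show ?thesis
      using 2 cyc_height_split[of i] cyc_height_Suc[of i]
      by (auto simp: laguerre_step_def cyc_label_def)
  next
    case 3
    then have "inv \<sigma> i \<noteq> i" by (simp add: perm_inv_simps)
    then show ?thesis
      using 3 ucross_unest[OF 3] cyc_height_split[of i] cyc_height_Suc[of i]
      by (auto simp: laguerre_step_def cyc_label_def of_bool_def split: if_splits)
  qed
qed

lemma cyc_height_1: "cyc_height \<sigma> 1 = 0"
  using perm_out(1)[of 0] by (auto simp: cyc_height_def)

lemma cyc_height_end: "cyc_height \<sigma> (Suc n) = 0"
proof -
  have "\<sigma> j \<le> n" if "j \<le> n" for j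
    using perm_range(1)[of j] perm_out(1)[of j] that by (cases "j = 0") auto
  then have "{j. j < Suc n \<and> Suc n \<le> \<sigma> j} = {}" by (fastforce simp: less_Suc_eq_le)
  then show ?thesis by (simp add: cyc_height_def)
qed

lemma cyc_weight:
  fixes a b c d :: "nat \<Rightarrow> nat \<Rightarrow> 'r::comm_semiring_1"
  shows "(\<Prod>i\<in>Cval n \<sigma>. a (ucross n i \<sigma>) (unest n i \<sigma>)) *
      (\<Prod>i\<in>Cpeak n \<sigma>. b (lcross n i \<sigma>) (lnest n i \<sigma>)) *
      (\<Prod>i\<in>Cdfall n \<sigma>. c (lcross n i \<sigma>) (lnest n i \<sigma>)) *
      (\<Prod>i\<in>Cdrise n \<sigma>. d (ucross n i \<sigma>) (unest n i \<sigma>)) *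
      (\<Prod>i\<in>Fix n \<sigma>. e (lev n i \<sigma>))
    = (\<Prod>i\<in>{1..n}. laguerre_weight a b c d e (cyc_height \<sigma> i) (cyc_label n \<sigma> i))"
proof -
  have sub: "Cval n \<sigma> \<subseteq> {1..n}" "Cpeak n \<sigma> \<subseteq> {1..n}" "Cdfall n \<sigma> \<subseteq> {1..n}"
      "Cdrise n \<sigma> \<subseteq> {1..n}" "Fix n \<sigma> \<subseteq> {1..n}"
    by (auto simp: Cval_def Cpeak_def Cdfall_def Cdrise_def Fix_def)
  show ?thesis
  proof (rule prod_five_subsets[OF finite_atLeastAtMost sub], goal_cases)
    case (1 i)
    consider "\<sigma> i < i" | "\<sigma> i = i" | "i < \<sigma> i" by linarith
    then show ?case
    proof cases
      case 1
      then have "inv \<sigma> i \<noteq> i" by (simp add: perm_inv_simps)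
      then show ?thesis
        using 1 \<open>i \<in> {1..n}\<close> lcross_lnest[OF 1]
        by (cases "inv \<sigma> i < i") (simp_all add: laguerre_weight_def cyc_label_def Cval_def Cpeak_def Cdfall_def Cdrise_def Fix_def)
    next
      case 2
      then have "inv \<sigma> i = i" by (simp add: perm_inv_simps)
      then show ?thesis
        using 2 \<open>i \<in> {1..n}\<close> cyc_height_split[of i] lev_alt[of i]
        by (simp add: laguerre_weight_def cyc_label_def Cval_def Cpeak_def Cdfall_def Cdrise_def Fix_def)
    next
      case 3
      then have "inv \<sigma> i \<noteq> i" by (simp add: perm_inv_simps)
      then show ?thesis
        using 3 \<open>i \<in> {1..n}\<close> ucross_unest[OF 3]
        by (cases "inv \<sigma> i < i") (simp_all add: laguerre_weight_def cyc_label_def Cval_def Cpeak_def Cdfall_def Cdrise_def Fix_def)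
    qed
  qed
qed

section \<open>Recovering a permutation from its cyclic labels\<close>

lemma lcross_open: "lcross n k \<sigma> = card {t \<in> {t. t < k \<and> k \<le> inv \<sigma> t}. \<sigma> k < t}"
  unfolding lcross_alt by (rule arg_cong[where f = card]) (auto simp: le_less perm_inv_simps)

text \<open>Here \<open>\<sigma> j\<close> itself belongs to the set of open targets, so
  \<open>ucross\<close> is its rank from below in that set, just as \<open>lcross\<close> is a rank
  from above. The weak inequality adds only \<open>\<sigma> j\<close>, which the strict comparison
  removes again.\<close>

lemma ucross_open: "ucross n j \<sigma> = card {t \<in> {t. j < t \<and> inv \<sigma> t \<le> j}. t < \<sigma> j}"
proof -
  have "\<sigma> ` {i. i < j \<and> j < \<sigma> i \<and> \<sigma> i < \<sigma> j} = {t \<in> {t. j < t \<and> inv \<sigma> t \<le> j}. t < \<sigma> j}"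
  proof (intro set_eqI iffI)
    fix t assume "t \<in> {t \<in> {t. j < t \<and> inv \<sigma> t \<le> j}. t < \<sigma> j}"
    then show "t \<in> \<sigma> ` {i. i < j \<and> j < \<sigma> i \<and> \<sigma> i < \<sigma> j}"
      using perm_inv_simps(1)[of t]
      by (intro image_eqI[of _ _ "inv \<sigma> t"]) (auto simp: le_less)
  qed (auto simp: perm_inv_simps(2))
  then show ?thesis
    unfolding ucross_alt using card_image[of \<sigma> "{i. i < j \<and> j < \<sigma> i \<and> \<sigma> i < \<sigma> j}"]
    by (simp add: inj_on_def perm_inv_simps(4))
qed

end

lemma card_above_inj:
  fixes S :: "'a::linorder set"
  assumes "finite S" "x \<in> S" "y \<in> S" "card {t \<in> S. x < t} = card {t \<in> S. y < t}"
  shows "x = y"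
proof -
  have "\<not> x < y" if "x \<in> S" "y \<in> S" "card {t \<in> S. x < t} = card {t \<in> S. y < t}" for x y
  proof
    assume "x < y"
    then have "{t \<in> S. y < t} \<subset> {t \<in> S. x < t}" using that by auto
    then have "card {t \<in> S. y < t} < card {t \<in> S. x < t}"
      using \<open>finite S\<close> by (intro psubset_card_mono) simp_all
    with that(3) show False by simp
  qed
  from this[OF assms(2-4)] this[OF assms(3,2) assms(4)[symmetric]] show ?thesis by simp
qed

lemma card_below_inj:
  fixes S :: "'a::linorder set"
  assumes "finite S" "x \<in> S" "y \<in> S" "card {t \<in> S. t < x} = card {t \<in> S. t < y}"
  shows "x = y"
proof -
  have "\<not> x < y" if "x \<in> S" "y \<in> S" "card {t \<in> S. t < x} = card {t \<in> S. t < y}" for x y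
  proof
    assume "x < y"
    then have "{t \<in> S. t < x} \<subset> {t \<in> S. t < y}" using that by auto
    then have "card {t \<in> S. t < x} < card {t \<in> S. t < y}"
      using \<open>finite S\<close> by (intro psubset_card_mono) simp_all
    with that(3) show False by simp
  qed
  from this[OF assms(2-4)] this[OF assms(3,2) assms(4)[symmetric]] show ?thesis by simp
qed

lemma cyc_label_fixed:
  assumes "\<sigma> permutes {1..n}"
  shows "\<sigma> i = i \<longleftrightarrow> (\<exists>x y k. cyc_label n \<sigma> i = (x, y, k) \<and> \<not> x \<and> \<not> y \<and> k = 0)"
  using perm_inv_simps(3)[OF assms, of i i] by (auto simp: cyc_label_def)

text \<open>The labels fix the type of every point. Lower arcs are then recovered in increasing
  order of their start and upper arcs in decreasing order: the arcs already known to agree determine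
  the open targets, and the crossing number selects one of them.\<close>

lemma cyc_label_inj:
  assumes \<sigma>: "\<sigma> permutes {1..n}" and \<tau>: "\<tau> permutes {1..n}"
    and lab: "\<And>i. i \<in> {1..n} \<Longrightarrow> cyc_label n \<sigma> i = cyc_label n \<tau> i"
  shows "\<sigma> = \<tau>"
proof -
  note S = perm_inv_simps[OF \<sigma>] and T = perm_inv_simps[OF \<tau>]
  have fixed: "\<sigma> i = i \<longleftrightarrow> \<tau> i = i" for i
    using lab[of i] cyc_label_fixed[OF \<sigma>, of i] cyc_label_fixed[OF \<tau>, of i] perm_out(1)[OF \<sigma>, of i] perm_out(1)[OF \<tau>, of i]
    by (cases "i \<in> {1..n}") auto
  have low: "\<sigma> i < i \<longleftrightarrow> \<tau> i < i" for i
    using lab[of i] perm_out(1)[OF \<sigma>, of i] perm_out(1)[OF \<tau>, of i]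
    by (cases "i \<in> {1..n}") (auto simp: cyc_label_def)
  have open_low: "inv \<sigma> i > i \<longleftrightarrow> inv \<tau> i > i" for i
    using lab[of i] perm_out(2)[OF \<sigma>, of i] perm_out(2)[OF \<tau>, of i]
    by (cases "i \<in> {1..n}") (auto simp: cyc_label_def)
  have up: "i < \<sigma> i \<longleftrightarrow> i < \<tau> i" for i
    using low[of i] fixed[of i] by linarith
  have open_up: "inv \<sigma> i < i \<longleftrightarrow> inv \<tau> i < i" for i
    using open_low[of i] fixed[of i] S(3)[of i i] T(3)[of i i] by linarith
  have lc: "lcross n i \<sigma> = lcross n i \<tau>" if "\<sigma> i < i" for i
  proof -
    have "i \<in> {1..n}" using perm_moved[OF \<sigma>, of i] that by auto
    from lab[OF this] that low[of i] show ?thesis by (auto simp: cyc_label_def)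
  qed
  have uc: "ucross n i \<sigma> = ucross n i \<tau>" if "i < \<sigma> i" for i
  proof -
    have "i \<in> {1..n}" using perm_moved[OF \<sigma>, of i] that by auto
    from lab[OF this] that up[of i] open_up[of i] show ?thesis by (auto simp: cyc_label_def)
  qed
  have L: "\<sigma> k = \<tau> k" if "\<sigma> k < k" for k
    using that
  proof (induction k rule: less_induct)
    case (less k)
    \<comment> \<open>By \<open>open_low\<close>, both permutations have the same targets of lower
      arcs. Those hit from a start before \<open>k\<close> agree by induction, so those still open
      agree too.\<close>
    have "{t. t < k \<and> k \<le> inv \<sigma> t} = {t. t < k \<and> k \<le> inv \<tau> t}"
    proof -
      have "k \<le> inv \<tau> t" if "t < k" "k \<le> inv \<sigma> t" for t
      proof (rule ccontr)
        assume "\<not> k \<le> inv \<tau> t"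
        moreover have "t < inv \<tau> t" using that open_low[of t] by simp
        ultimately show False
          using less.IH[of "inv \<tau> t"] low[of "inv \<tau> t"] T(1)[of t] S(3)[of t "inv \<tau> t"] that by auto
      qed
      moreover have "k \<le> inv \<sigma> t" if "t < k" "k \<le> inv \<tau> t" for t
      proof (rule ccontr)
        assume "\<not> k \<le> inv \<sigma> t"
        moreover have "t < inv \<sigma> t" using that open_low[of t] by simp
        ultimately show False
          using less.IH[of "inv \<sigma> t"] S(1)[of t] T(3)[of t "inv \<sigma> t"] that by auto
      qed
      ultimately show ?thesis by blast
    qed
    note opens = this
    have \<tau>k: "\<tau> k < k" using less.prems low[of k] by simp
    show ?case
    proof (rule card_above_inj)
      show "finite {t. t < k \<and> k \<le> inv \<sigma> t}" by simp
      show "\<sigma> k \<in> {t. t < k \<and> k \<le> inv \<sigma> t}" using less.prems by (simp add: S(2))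
      show "\<tau> k \<in> {t. t < k \<and> k \<le> inv \<sigma> t}" unfolding opens using \<tau>k by (simp add: T(2))
      show "card {t \<in> {t. t < k \<and> k \<le> inv \<sigma> t}. \<sigma> k < t} = card {t \<in> {t. t < k \<and> k \<le> inv \<sigma> t}. \<tau> k < t}"
        using lc[OF less.prems] unfolding lcross_open[OF \<sigma>] lcross_open[OF \<tau>] opens .
    qed
  qed
  have U: "\<sigma> j = \<tau> j" if "j < \<sigma> j" for j
    using that
  \<comment> \<open>Upward arcs need the opposite direction: the targets above \<open>j\<close> that
    are hit from beyond \<open>j\<close> must already be known.\<close>
  proof (induction "n - j" arbitrary: j rule: less_induct)
    case less
    have "n - i < n - j" if "j < i" "i < \<sigma> i" for i
      using perm_moved[OF \<sigma>, of i] that by auto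
    then have IH: "\<sigma> i = \<tau> i" if "j < i" "i < \<sigma> i" for i
      using less.hyps that by blast
    have "{t. j < t \<and> inv \<sigma> t \<le> j} = {t. j < t \<and> inv \<tau> t \<le> j}"
    proof -
      have "inv \<tau> t \<le> j" if "j < t" "inv \<sigma> t \<le> j" for t
      proof (rule ccontr)
        assume "\<not> inv \<tau> t \<le> j"
        moreover have "inv \<tau> t < t" using that open_up[of t] by simp
        ultimately show False
          using IH[of "inv \<tau> t"] up[of "inv \<tau> t"] T(1)[of t] S(3)[of t "inv \<tau> t"] that by auto
      qed
      moreover have "inv \<sigma> t \<le> j" if "j < t" "inv \<tau> t \<le> j" for t
      proof (rule ccontr)
        assume "\<not> inv \<sigma> t \<le> j"
        moreover have "inv \<sigma> t < t" using that open_up[of t] by simp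
        ultimately show False
          using IH[of "inv \<sigma> t"] S(1)[of t] T(3)[of t "inv \<sigma> t"] that by auto
      qed
      ultimately show ?thesis by blast
    qed
    note opens = this
    have \<tau>j: "j < \<tau> j" using less.prems up[of j] by simp
    \<comment> \<open>The open targets are bounded only from below by definition; finiteness comes
      from their preimages in \<open>{..j}\<close>.\<close>
    have fin: "finite {t. j < t \<and> inv \<sigma> t \<le> j}"
    proof (rule finite_subset[of _ "\<sigma> ` {..j}"])
      show "{t. j < t \<and> inv \<sigma> t \<le> j} \<subseteq> \<sigma> ` {..j}"
        using S(1) by (intro subsetI image_eqI[of _ _ "inv \<sigma> _"]) auto
    qed simp
    show ?case
    proof (rule card_below_inj[OF fin])
      show "\<sigma> j \<in> {t. j < t \<and> inv \<sigma> t \<le> j}" using less.prems by (simp add: S(2))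
      show "\<tau> j \<in> {t. j < t \<and> inv \<sigma> t \<le> j}" unfolding opens using \<tau>j by (simp add: T(2))
      show "card {t \<in> {t. j < t \<and> inv \<sigma> t \<le> j}. t < \<sigma> j} = card {t \<in> {t. j < t \<and> inv \<sigma> t \<le> j}. t < \<tau> j}"
        using uc[OF less.prems] unfolding ucross_open[OF \<sigma>] ucross_open[OF \<tau>] opens .
    qed
  qed
  show ?thesis
  proof
    fix i
    consider "\<sigma> i < i" | "\<sigma> i = i" | "i < \<sigma> i" by linarith
    then show "\<sigma> i = \<tau> i" using L U fixed by cases auto
  qed
qed

lemma Qpoly_histories:
  "Qpoly n a b c d e = (\<Sum>w\<in>histories n 0. weight (laguerre_weight a b c d e) w)"
proof -
  have "Qpoly n a b c d e = (\<Sum>\<sigma> | \<sigma> permutes {1..n}.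
      \<Prod>i\<in>{1..n}. laguerre_weight a b c d e (cyc_height \<sigma> i) (cyc_label n \<sigma> i))"
    unfolding Qpoly_def by (rule sum.cong[OF refl], rule cyc_weight[where a = a and b = b and c = c and d = d and e = e], simp)
  also have "\<dots> = (\<Sum>w\<in>histories n 0. weight (laguerre_weight a b c d e) w)"
  proof (rule sum_histories[where hh = cyc_height and f = "cyc_label n" and W = "laguerre_weight a b c d e" and n = n])
    show "cyc_height \<sigma> 1 = 0" "cyc_height \<sigma> (Suc n) = 0" if "\<sigma> permutes {1..n}" for \<sigma>
      using cyc_height_1[OF that] cyc_height_end[OF that] by auto
    show "laguerre_step (cyc_height \<sigma> i) (cyc_label n \<sigma> i) (cyc_height \<sigma> (Suc i))"
      if "\<sigma> permutes {1..n}" "i \<in> {1..n}" for \<sigma> i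
      using cyc_step that by blast
    show "\<sigma> = \<tau>" if "\<sigma> permutes {1..n}" "\<tau> permutes {1..n}"
        "\<And>i. i \<in> {1..n} \<Longrightarrow> cyc_label n \<sigma> i = cyc_label n \<tau> i" for \<sigma> \<tau>
      using that by (rule cyc_label_inj)
  qed
  finally show ?thesis .
qed

section \<open>The linear side\<close>

text \<open>No range is imposed on \<open>p\<close>, since the boundary convention excludes descents
  at position 0 and from position \<open>n\<close> on.\<close>

definition lin_height :: "(nat \<Rightarrow> nat) \<Rightarrow> nat \<Rightarrow> nat" where
  "lin_height \<sigma> i = card {p. \<sigma> (Suc p) < i \<and> i \<le> \<sigma> p}"

definition lin_label :: "(nat \<Rightarrow> nat) \<Rightarrow> nat \<Rightarrow> bool \<times> bool \<times> nat" where
  "lin_label \<sigma> i = (i < \<sigma> (inv \<sigma> i - 1), \<sigma> (Suc (inv \<sigma> i)) < i, pat31_2 i \<sigma>)"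

text \<open>For \<open>i\<close> in \<open>{1..n}\<close>, the positions with values below
  \<open>i\<close> form maximal runs; these are the first values of all runs except the one through
  position 0. The wording uses only adjacency among values below \<open>i\<close>, which is what the
  reconstruction knows when it reaches \<open>i\<close>.\<close>

definition block_starts :: "(nat \<Rightarrow> nat) \<Rightarrow> nat \<Rightarrow> nat set" where
  "block_starts \<sigma> i = {b. 0 < b \<and> b < i \<and> (\<forall>u<i. Suc (inv \<sigma> u) \<noteq> inv \<sigma> b)}"

context
  fixes n :: nat and \<sigma> :: "nat \<Rightarrow> nat"
  assumes perm: "\<sigma> permutes {1..n}"
begin

private lemmas inv_simps = perm_inv_simps[OF perm]

lemma perm_0: "\<sigma> 0 = 0" "inv \<sigma> 0 = 0"
  using perm_out[OF perm, of 0] by auto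

lemma perm_le: "p \<le> n \<Longrightarrow> \<sigma> p \<le> n"
  using perm_range(1)[OF perm, of p] perm_0 by (cases "p = 0") auto

lemma descent_position:
  assumes "\<sigma> (Suc p) < \<sigma> p"
  shows "0 < p" "p < n"
proof -
  show "0 < p" using assms perm_0(1) by (cases p) auto
  show "p < n"
  proof (rule ccontr)
    assume "\<not> p < n"
    then have "\<sigma> (Suc p) = Suc p" using perm_out(1)[OF perm, of "Suc p"] by simp
    moreover have "\<sigma> p \<le> p"
      using \<open>\<not> p < n\<close> perm_le[of p] perm_out(1)[OF perm, of p] by (cases "p = n") auto
    ultimately show False using assms by simp
  qed
qed

lemma finite_descents: "finite {p. \<sigma> (Suc p) < \<sigma> p}"
  by (rule finite_subset[of _ "{..<n}"]) (auto dest: descent_position)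

lemma pos_inv: "0 < i \<Longrightarrow> 0 < inv \<sigma> i"
  using inv_simps(3)[of i 0] perm_0 by (cases "inv \<sigma> i = 0") auto

lemma pat31_2_alt: "pat31_2 i \<sigma> = card {p. Suc p < inv \<sigma> i \<and> \<sigma> (Suc p) < i \<and> i < \<sigma> p}"
proof -
  have "{j. 1 < j \<and> j < inv \<sigma> i \<and> \<sigma> j < i \<and> i < \<sigma> (j - 1)} =
      Suc ` {p. Suc p < inv \<sigma> i \<and> \<sigma> (Suc p) < i \<and> i < \<sigma> p}"
  proof (intro set_eqI iffI)
    fix j assume "j \<in> {j. 1 < j \<and> j < inv \<sigma> i \<and> \<sigma> j < i \<and> i < \<sigma> (j - 1)}"
    then show "j \<in> Suc ` {p. Suc p < inv \<sigma> i \<and> \<sigma> (Suc p) < i \<and> i < \<sigma> p}"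
      by (intro image_eqI[of _ _ "j - 1"]) auto
  next
    fix j assume "j \<in> Suc ` {p. Suc p < inv \<sigma> i \<and> \<sigma> (Suc p) < i \<and> i < \<sigma> p}"
    then obtain p where p: "j = Suc p" "Suc p < inv \<sigma> i" "\<sigma> (Suc p) < i" "i < \<sigma> p" by blast
    then have "0 < p" using descent_position(1)[of p] by simp
    with p show "j \<in> {j. 1 < j \<and> j < inv \<sigma> i \<and> \<sigma> j < i \<and> i < \<sigma> (j - 1)}" by simp
  qed
  then show ?thesis by (simp add: pat31_2_def card_image)
qed

lemma pat2_31_alt: "pat2_31 n i \<sigma> = card {p. inv \<sigma> i < p \<and> \<sigma> (Suc p) < i \<and> i < \<sigma> p}"
proof -
  have "p < n" if "\<sigma> (Suc p) < i" "i < \<sigma> p" for p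
    using descent_position(2)[of p] that by simp
  then show ?thesis
    unfolding pat2_31_def by (intro arg_cong[where f = card]) auto
qed

text \<open>The value \<open>i\<close> stands at neither end of such a descent, so the descent lies
  entirely to its left or entirely to its right.\<close>

lemma straddling_descents:
  "card {p. \<sigma> (Suc p) < i \<and> i < \<sigma> p} = pat31_2 i \<sigma> + pat2_31 n i \<sigma>"
proof -
  let ?L = "{p. Suc p < inv \<sigma> i \<and> \<sigma> (Suc p) < i \<and> i < \<sigma> p}"
  let ?R = "{p. inv \<sigma> i < p \<and> \<sigma> (Suc p) < i \<and> i < \<sigma> p}"
  have "Suc p < inv \<sigma> i \<or> inv \<sigma> i < p" if "\<sigma> (Suc p) < i" "i < \<sigma> p" for p
  proof -
    have "inv \<sigma> i \<noteq> p" "inv \<sigma> i \<noteq> Suc p" using that inv_simps(3) by auto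
    then show ?thesis by linarith
  qed
  then have eq: "{p. \<sigma> (Suc p) < i \<and> i < \<sigma> p} = ?L \<union> ?R" by blast
  have "finite ?L" "finite ?R"
    by (rule finite_subset[OF _ finite_descents]; auto)+
  then have "card (?L \<union> ?R) = card ?L + card ?R"
    by (intro card_Un_disjoint) auto
  then show ?thesis unfolding eq pat31_2_alt pat2_31_alt .
qed

lemma finite_straddling: "finite {p. \<sigma> (Suc p) < i \<and> i < \<sigma> p}"
  by (rule finite_subset[OF _ finite_descents]) auto

text \<open>The weak inequality in the height admits one further descent, the one that starts at the
  value \<open>i\<close>.\<close>

lemma lin_height_split:
  "lin_height \<sigma> i = pat31_2 i \<sigma> + pat2_31 n i \<sigma> + of_bool (\<sigma> (Suc (inv \<sigma> i)) < i)"
proof -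
  have "i = \<sigma> p \<longleftrightarrow> p = inv \<sigma> i" for p using inv_simps(3)[of i p] by auto
  then have "i \<le> \<sigma> p \<longleftrightarrow> i < \<sigma> p \<or> p = inv \<sigma> i" for p by (simp add: le_less)
  then have "{p. \<sigma> (Suc p) < i \<and> i \<le> \<sigma> p} =
      {p. \<sigma> (Suc p) < i \<and> i < \<sigma> p} \<union> (if \<sigma> (Suc (inv \<sigma> i)) < i then {inv \<sigma> i} else {})"
    by auto
  moreover have "card ({p. \<sigma> (Suc p) < i \<and> i < \<sigma> p} \<union> (if \<sigma> (Suc (inv \<sigma> i)) < i then {inv \<sigma> i} else {}))
      = card {p. \<sigma> (Suc p) < i \<and> i < \<sigma> p} + card (if \<sigma> (Suc (inv \<sigma> i)) < i then {inv \<sigma> i} else {})"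
    using finite_straddling by (intro card_Un_disjoint) (auto simp: inv_simps(1))
  ultimately show ?thesis by (simp add: lin_height_def straddling_descents)
qed

text \<open>Now the further descent is the one that ends at \<open>i\<close>; \<open>0 < i\<close>
  guarantees a position before it.\<close>

lemma lin_height_Suc:
  assumes "0 < i"
  shows "lin_height \<sigma> (Suc i) = pat31_2 i \<sigma> + pat2_31 n i \<sigma> + of_bool (i < \<sigma> (inv \<sigma> i - 1))"
proof -
  let ?p = "inv \<sigma> i - 1"
  have p: "Suc ?p = inv \<sigma> i" using pos_inv[OF assms] by simp
  have "\<sigma> (Suc p) = i \<longleftrightarrow> p = ?p" for p
    using inv_simps(3)[of i "Suc p"] p by auto
  then have "{p. \<sigma> (Suc p) < Suc i \<and> Suc i \<le> \<sigma> p} =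
      {p. \<sigma> (Suc p) < i \<and> i < \<sigma> p} \<union> (if i < \<sigma> ?p then {?p} else {})"
    by (auto simp: less_Suc_eq Suc_le_eq)
  moreover have "card ({p. \<sigma> (Suc p) < i \<and> i < \<sigma> p} \<union> (if i < \<sigma> ?p then {?p} else {}))
      = card {p. \<sigma> (Suc p) < i \<and> i < \<sigma> p} + card (if i < \<sigma> ?p then {?p} else {})"
    using finite_straddling p by (intro card_Un_disjoint) (auto simp: inv_simps(1))
  ultimately show ?thesis by (simp add: lin_height_def straddling_descents)
qed

lemma lin_step:
  assumes "i \<in> {1..n}"
  shows "laguerre_step (lin_height \<sigma> i) (lin_label \<sigma> i) (lin_height \<sigma> (Suc i))"
  using assms lin_height_Suc[of i]
  by (simp add: laguerre_step_def lin_label_def lin_height_split)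

lemma lin_height_1: "lin_height \<sigma> 1 = 0"
proof -
  have "\<sigma> (Suc p) \<noteq> 0" for p using inv_simps(4)[of "Suc p" 0] perm_0 by auto
  then have "{p. \<sigma> (Suc p) < 1 \<and> 1 \<le> \<sigma> p} = {}" by simp
  then show ?thesis unfolding lin_height_def by (simp only: card.empty)
qed

lemma lin_height_end: "lin_height \<sigma> (Suc n) = 0"
proof -
  have "\<not> (\<sigma> (Suc p) < Suc n \<and> Suc n \<le> \<sigma> p)" for p
    using descent_position(2)[of p] perm_le[of p] by auto
  then have "{p. \<sigma> (Suc p) < Suc n \<and> Suc n \<le> \<sigma> p} = {}" by blast
  then show ?thesis unfolding lin_height_def by (simp only: card.empty)
qed

lemma value_iff:
  assumes "i \<in> {1..n}"
  shows "i \<in> {\<sigma> p | p. p \<in> {1..n} \<and> P p} \<longleftrightarrow> P (inv \<sigma> i)"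
proof
  assume "i \<in> {\<sigma> p | p. p \<in> {1..n} \<and> P p}"
  then obtain p where "i = \<sigma> p" "P p" by blast
  then show "P (inv \<sigma> i)" by (simp add: inv_simps(2))
next
  assume "P (inv \<sigma> i)"
  moreover have "inv \<sigma> i \<in> {1..n}" using assms perm_range(2)[OF perm] by blast
  moreover have "i = \<sigma> (inv \<sigma> i)" by (simp only: inv_simps(1))
  ultimately show "i \<in> {\<sigma> p | p. p \<in> {1..n} \<and> P p}" by blast
qed

text \<open>If a larger value occurs before \<open>i\<close>, the word must come back below
  \<open>i\<close> before reaching it, because the entry just before \<open>i\<close> is smaller.
  Hence double ascents outside \<open>Fmax\<close> have positive label, and
  \<open>pat31_2 i \<sigma> - 1\<close> does not truncate there.\<close>

lemma foremaximum_iff: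
  assumes "i \<in> {1..n}" and "\<sigma> (inv \<sigma> i - 1) < i"
  shows "(\<forall>j\<in>{1..<inv \<sigma> i}. \<sigma> j < i) \<longleftrightarrow> pat31_2 i \<sigma> = 0"
proof
  assume max: "\<forall>j\<in>{1..<inv \<sigma> i}. \<sigma> j < i"
  have "\<not> (Suc p < inv \<sigma> i \<and> \<sigma> (Suc p) < i \<and> i < \<sigma> p)" for p
    using max[rule_format, of p] descent_position(1)[of p] by auto
  then have "{p. Suc p < inv \<sigma> i \<and> \<sigma> (Suc p) < i \<and> i < \<sigma> p} = {}" by blast
  then show "pat31_2 i \<sigma> = 0" unfolding pat31_2_alt by (simp only: card.empty)
next
  assume "pat31_2 i \<sigma> = 0"
  moreover have "finite {p. Suc p < inv \<sigma> i \<and> \<sigma> (Suc p) < i \<and> i < \<sigma> p}"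
    by (rule finite_subset[of _ "{..<inv \<sigma> i}"]) auto
  ultimately have none: "\<not> (Suc p < inv \<sigma> i \<and> \<sigma> (Suc p) < i \<and> i < \<sigma> p)" for p
    unfolding pat31_2_alt card_eq_0_iff by blast
  show "\<forall>j\<in>{1..<inv \<sigma> i}. \<sigma> j < i"
  proof (rule ccontr)
    assume "\<not> (\<forall>j\<in>{1..<inv \<sigma> i}. \<sigma> j < i)"
    then obtain j where j: "j < inv \<sigma> i" "i \<le> \<sigma> j" by auto
    \<comment> \<open>At the last position before \<open>i\<close> carrying a value at least
      \<open>i\<close>, the next entry is smaller than \<open>i\<close>, which exhibits a forbidden
      descent.\<close>
    define q where "q = Max {j. j < inv \<sigma> i \<and> i \<le> \<sigma> j}"
    have "q \<in> {j. j < inv \<sigma> i \<and> i \<le> \<sigma> j}"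
      unfolding q_def by (rule Max_in) (use j in auto)
    then have q: "q < inv \<sigma> i" "i \<le> \<sigma> q" by auto
    have max: "j \<le> q" if "j < inv \<sigma> i" "i \<le> \<sigma> j" for j
      unfolding q_def by (rule Max_ge) (use that in auto)
    have "\<sigma> q \<noteq> i" using q(1) inv_simps(3)[of i q] by auto
    moreover have "q \<noteq> inv \<sigma> i - 1" using assms(2) q(2) by auto
    ultimately have "Suc q < inv \<sigma> i" "i < \<sigma> q" using q by auto
    moreover from this have "\<sigma> (Suc q) < i" using max[of "Suc q"] by (meson Suc_n_not_le_n not_le)
    ultimately show False using none by blast
  qed
qed

lemma lin_weight:
  fixes a b c d :: "nat \<Rightarrow> nat \<Rightarrow> 'r::comm_semiring_1"
  shows "(\<Prod>i\<in>Val n \<sigma>. a (pat31_2 i \<sigma>) (pat2_31 n i \<sigma>)) *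
      (\<Prod>i\<in>Peak n \<sigma>. b (pat31_2 i \<sigma>) (pat2_31 n i \<sigma>)) *
      (\<Prod>i\<in>Ddes n \<sigma>. c (pat31_2 i \<sigma>) (pat2_31 n i \<sigma>)) *
      (\<Prod>i\<in>Dasc n \<sigma> - Fmax n \<sigma>. d (pat31_2 i \<sigma> - 1) (pat2_31 n i \<sigma>)) *
      (\<Prod>i\<in>Fmax n \<sigma>. e (pat2_31 n i \<sigma>))
    = (\<Prod>i\<in>{1..n}. laguerre_weight a b c d e (lin_height \<sigma> i) (lin_label \<sigma> i))"
proof -
  have "{\<sigma> p | p. p \<in> {1..n} \<and> P p} \<subseteq> {1..n}" for P
    using perm_range(1)[OF perm] by blast
  then have sub: "Val n \<sigma> \<subseteq> {1..n}" "Peak n \<sigma> \<subseteq> {1..n}" "Ddes n \<sigma> \<subseteq> {1..n}"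
      "Dasc n \<sigma> - Fmax n \<sigma> \<subseteq> {1..n}" "Fmax n \<sigma> \<subseteq> {1..n}"
    unfolding Val_def Peak_def Ddes_def Dasc_def Fmax_def by blast+
  show ?thesis
  proof (rule prod_five_subsets[OF finite_atLeastAtMost sub], goal_cases)
    case (1 i)
    let ?p = "inv \<sigma> i"
    have mem: "i \<in> Val n \<sigma> \<longleftrightarrow> i < \<sigma> (?p - 1) \<and> i < \<sigma> (Suc ?p)"
        "i \<in> Peak n \<sigma> \<longleftrightarrow> \<sigma> (?p - 1) < i \<and> \<sigma> (Suc ?p) < i"
        "i \<in> Ddes n \<sigma> \<longleftrightarrow> i < \<sigma> (?p - 1) \<and> \<sigma> (Suc ?p) < i"
        "i \<in> Dasc n \<sigma> \<longleftrightarrow> \<sigma> (?p - 1) < i \<and> i < \<sigma> (Suc ?p)"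
        "i \<in> Fmax n \<sigma> \<longleftrightarrow> \<sigma> (?p - 1) < i \<and> i < \<sigma> (Suc ?p) \<and> (\<forall>j\<in>{1..<?p}. \<sigma> j < i)"
      unfolding Val_def Peak_def Ddes_def Dasc_def Fmax_def value_iff[OF 1]
      by (simp_all add: inv_simps(1))
    have "\<sigma> (?p - 1) \<noteq> i" "\<sigma> (Suc ?p) \<noteq> i"
      using inv_simps(3)[of i "?p - 1"] inv_simps(3)[of i "Suc ?p"] pos_inv[of i] 1 by auto
    then have ne: "\<not> \<sigma> (?p - 1) < i \<longleftrightarrow> i < \<sigma> (?p - 1)" "\<not> \<sigma> (Suc ?p) < i \<longleftrightarrow> i < \<sigma> (Suc ?p)"
      by auto
    have fm: "(\<forall>j\<in>{1..<?p}. \<sigma> j < i) \<longleftrightarrow> pat31_2 i \<sigma> = 0" if "\<sigma> (?p - 1) < i"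
      using foremaximum_iff[OF 1 that] .
    have y: "i < \<sigma> (Suc ?p) \<longleftrightarrow> \<not> \<sigma> (Suc ?p) < i" using ne(2) by blast
    show ?case
    proof (cases "\<sigma> (?p - 1) < i")
      case True
      then have "\<not> i < \<sigma> (?p - 1)" by simp
      with True show ?thesis
        unfolding Diff_iff mem fm[OF True] y laguerre_weight_def lin_label_def lin_height_split by simp
    next
      case False
      then have "i < \<sigma> (?p - 1)" using ne(1) by blast
      with False show ?thesis
        unfolding Diff_iff mem y laguerre_weight_def lin_label_def lin_height_split by simp
    qed
  qed
qed

section \<open>Recovering a permutation from its linear labels\<close>

lemma pat31_2_block_starts:
  assumes "i \<in> {1..n}"
  shows "pat31_2 i \<sigma> = card {b \<in> block_starts \<sigma> i. inv \<sigma> b < inv \<sigma> i}"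
proof -
  let ?L = "{p. Suc p < inv \<sigma> i \<and> \<sigma> (Suc p) < i \<and> i < \<sigma> p}"
  \<comment> \<open>The lower end of a straddling descent starts a block, as its predecessor exceeds
    \<open>i\<close>. Conversely the predecessor of a block start is at least \<open>i\<close>, and
    it is not \<open>i\<close> when the block lies before \<open>i\<close>.\<close>
  have "(\<lambda>p. \<sigma> (Suc p)) ` ?L = {b \<in> block_starts \<sigma> i. inv \<sigma> b < inv \<sigma> i}"
  proof (intro set_eqI iffI)
    fix b assume "b \<in> (\<lambda>p. \<sigma> (Suc p)) ` ?L"
    then obtain p where p: "b = \<sigma> (Suc p)" "Suc p < inv \<sigma> i" "b < i" "i < \<sigma> p" by auto
    have "b \<noteq> 0" using p(1) inv_simps(4)[of "Suc p" 0] perm_0 by auto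
    moreover have "Suc (inv \<sigma> u) \<noteq> Suc p" if "u < i" for u
      using that p(4) inv_simps(3)[of u p] by auto
    ultimately show "b \<in> {b \<in> block_starts \<sigma> i. inv \<sigma> b < inv \<sigma> i}"
      using p by (auto simp: block_starts_def inv_simps(2))
  next
    fix b assume "b \<in> {b \<in> block_starts \<sigma> i. inv \<sigma> b < inv \<sigma> i}"
    then have b: "0 < b" "b < i" "\<And>u. u < i \<Longrightarrow> Suc (inv \<sigma> u) \<noteq> inv \<sigma> b" "inv \<sigma> b < inv \<sigma> i"
      by (auto simp: block_starts_def)
    obtain p where p: "inv \<sigma> b = Suc p" using pos_inv[OF b(1)] gr0_implies_Suc by blast
    have "\<not> \<sigma> p < i" using b(3)[of "\<sigma> p"] p by (auto simp: inv_simps(2))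
    moreover have "\<sigma> p \<noteq> i" using inv_simps(3)[of i p] b(4) p by auto
    moreover have "\<sigma> (Suc p) = b" using p inv_simps(3) by blast
    ultimately show "b \<in> (\<lambda>p. \<sigma> (Suc p)) ` ?L"
      using b p by (intro image_eqI[of _ _ p]) auto
  qed
  moreover have "inj_on (\<lambda>p. \<sigma> (Suc p)) ?L" by (simp add: inj_on_def inv_simps(4))
  ultimately show ?thesis
    unfolding pat31_2_alt using card_image[of "\<lambda>p. \<sigma> (Suc p)" ?L] by simp
qed

text \<open>Among the values below \<open>i\<close>, those preceding \<open>i\<close> are the ones whose maximal block of
  positions with values below \<open>i\<close> is among the first \<open>pat31_2 i \<sigma> + 1\<close> blocks.\<close>

lemma precedes_iff:
  assumes "i \<in> {1..n}" and "v < i"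
  shows "inv \<sigma> v < inv \<sigma> i \<longleftrightarrow> card {b \<in> block_starts \<sigma> i. inv \<sigma> b \<le> inv \<sigma> v} \<le> pat31_2 i \<sigma>"
proof -
  have fin: "finite {b \<in> block_starts \<sigma> i. P b}" for P
    by (rule finite_subset[of _ "{..<i}"]) (auto simp: block_starts_def)
  have ne: "inv \<sigma> v \<noteq> inv \<sigma> i" using assms(2) inv_simps(1) by (metis less_irrefl)
  show ?thesis
  proof
    assume "inv \<sigma> v < inv \<sigma> i"
    then show "card {b \<in> block_starts \<sigma> i. inv \<sigma> b \<le> inv \<sigma> v} \<le> pat31_2 i \<sigma>"
      unfolding pat31_2_block_starts[OF assms(1)] by (intro card_mono fin) auto
  next
    assume le: "card {b \<in> block_starts \<sigma> i. inv \<sigma> b \<le> inv \<sigma> v} \<le> pat31_2 i \<sigma>"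
    show "inv \<sigma> v < inv \<sigma> i"
    proof (rule ccontr)
      assume "\<not> inv \<sigma> v < inv \<sigma> i"
      with ne have v: "inv \<sigma> i < inv \<sigma> v" by simp
      \<comment> \<open>The first value below \<open>i\<close> to the right of \<open>i\<close>
        starts a block, since \<open>i\<close> or a larger value stands just before it. This block
        start is counted for \<open>v\<close> but not for \<open>i\<close>.\<close>
      define p where "p = (LEAST p. inv \<sigma> i < p \<and> \<sigma> p < i)"
      have "inv \<sigma> i < inv \<sigma> v \<and> \<sigma> (inv \<sigma> v) < i" using v assms(2) by (simp add: inv_simps(1))
      then have p: "inv \<sigma> i < p" "\<sigma> p < i" and pv: "p \<le> inv \<sigma> v"
        unfolding p_def by (auto intro: LeastI2 Least_le)
      have least: "\<not> (inv \<sigma> i < q \<and> \<sigma> q < i)" if "q < p" for q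
        using that not_less_Least unfolding p_def by blast
      have "Suc (inv \<sigma> u) \<noteq> p" if "u < i" for u
      proof
        assume "Suc (inv \<sigma> u) = p"
        moreover have "inv \<sigma> u \<noteq> inv \<sigma> i" using that inv_simps(1) by (metis less_irrefl)
        ultimately show False using least[of "inv \<sigma> u"] p(1) that by (simp add: inv_simps(1))
      qed
      moreover have "\<sigma> p \<noteq> 0" using p(1) inv_simps(4)[of p 0] perm_0 by auto
      ultimately have "\<sigma> p \<in> {b \<in> block_starts \<sigma> i. inv \<sigma> b \<le> inv \<sigma> v}"
        using p pv by (auto simp: block_starts_def inv_simps(2))
      moreover have "\<sigma> p \<notin> {b \<in> block_starts \<sigma> i. inv \<sigma> b < inv \<sigma> i}"
        using p by (simp add: inv_simps(2))
      ultimately have "{b \<in> block_starts \<sigma> i. inv \<sigma> b < inv \<sigma> i} \<subset> {b \<in> block_starts \<sigma> i. inv \<sigma> b \<le> inv \<sigma> v}"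
        using v by auto
      then have "pat31_2 i \<sigma> < card {b \<in> block_starts \<sigma> i. inv \<sigma> b \<le> inv \<sigma> v}"
        unfolding pat31_2_block_starts[OF assms(1)] by (intro psubset_card_mono fin)
      with le show False by simp
    qed
  qed
qed

text \<open>The first bit of the label tells whether the left neighbour of \<open>i\<close> is
  smaller; if so, it is the last of the smaller values preceding \<open>i\<close>. With
  \<open>successor_iff\<close>, its mirror image for the second bit, this reduces new adjacencies to
  order and labels.\<close>

lemma predecessor_iff:
  assumes "i \<in> {1..n}" and "u < i"
  shows "Suc (inv \<sigma> u) = inv \<sigma> i \<longleftrightarrow> \<not> i < \<sigma> (inv \<sigma> i - 1) \<and> inv \<sigma> u < inv \<sigma> i \<and>
    (\<forall>w<i. inv \<sigma> w < inv \<sigma> i \<longrightarrow> \<not> inv \<sigma> u < inv \<sigma> w)" (is "?l \<longleftrightarrow> ?r")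
proof
  assume ?l
  then have "inv \<sigma> i - 1 = inv \<sigma> u" by simp
  then show ?r using \<open>?l\<close> assms(2) by (auto simp: inv_simps(1))
next
  assume r: ?r
  have p: "0 < inv \<sigma> i" using pos_inv assms(1) by simp
  let ?w = "\<sigma> (inv \<sigma> i - 1)"
  have "?w \<noteq> i" using p inv_simps(3)[of i "inv \<sigma> i - 1"] by auto
  with r have "?w < i" by simp
  with r p have "\<not> inv \<sigma> u < inv \<sigma> i - 1" by (auto simp: inv_simps(2))
  with r have "inv \<sigma> u = inv \<sigma> i - 1" by linarith
  with p show ?l by simp
qed

lemma successor_iff:
  assumes "v < i"
  shows "Suc (inv \<sigma> i) = inv \<sigma> v \<longleftrightarrow> \<sigma> (Suc (inv \<sigma> i)) < i \<and> inv \<sigma> i < inv \<sigma> v \<and>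
    (\<forall>w<i. inv \<sigma> i < inv \<sigma> w \<longrightarrow> \<not> inv \<sigma> w < inv \<sigma> v)" (is "?l \<longleftrightarrow> ?r")
proof
  assume l: ?l
  then have "\<sigma> (Suc (inv \<sigma> i)) = v" by (simp add: inv_simps(1))
  then show ?r using l assms by auto
next
  assume r: ?r
  then have "\<not> Suc (inv \<sigma> i) < inv \<sigma> v" by (auto simp: inv_simps(2))
  with r show ?l by simp
qed

text \<open>Relative order alone gives back the positions. The value 0 at position 0 is counted too,
  so the rank is the position itself, without a shift.\<close>

lemma inv_eq_card:
  assumes "v \<le> n"
  shows "inv \<sigma> v = card {u. u \<le> n \<and> inv \<sigma> u < inv \<sigma> v}"
proof -
  have le: "inv \<sigma> v \<le> n"
    using assms perm_range(2)[OF perm, of v] perm_0 by (cases "v = 0") auto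
  have "{u. u \<le> n \<and> inv \<sigma> u < inv \<sigma> v} = \<sigma> ` {..<inv \<sigma> v}"
  proof (intro set_eqI iffI)
    fix u assume "u \<in> {u. u \<le> n \<and> inv \<sigma> u < inv \<sigma> v}"
    then show "u \<in> \<sigma> ` {..<inv \<sigma> v}"
      by (intro image_eqI[of _ _ "inv \<sigma> u"]) (auto simp: inv_simps(1))
  next
    fix u assume "u \<in> \<sigma> ` {..<inv \<sigma> v}"
    then obtain p where p: "u = \<sigma> p" "p < inv \<sigma> v" by blast
    then have "u \<le> n" using le perm_le[of p] by simp
    with p show "u \<in> {u. u \<le> n \<and> inv \<sigma> u < inv \<sigma> v}"
      by (simp add: inv_simps(2))
  qed
  moreover have "inj_on \<sigma> {..<inv \<sigma> v}" by (simp add: inj_on_def inv_simps(4))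
  ultimately show ?thesis using card_image[of \<sigma> "{..<inv \<sigma> v}"] by simp
qed

end

text \<open>The induction carries order and adjacency together: adjacency below \<open>i\<close>
  yields the blocks, the label then tells after which block \<open>i\<close> falls, and the two bits
  say whether it touches its neighbours among the smaller values.\<close>

lemma lin_label_inj:
  assumes \<sigma>: "\<sigma> permutes {1..n}" and \<tau>: "\<tau> permutes {1..n}"
    and lab: "\<And>i. i \<in> {1..n} \<Longrightarrow> lin_label \<sigma> i = lin_label \<tau> i"
  shows "\<sigma> = \<tau>"
proof -
  have same: "(\<forall>u<i. \<forall>v<i. (inv \<sigma> u < inv \<sigma> v \<longleftrightarrow> inv \<tau> u < inv \<tau> v) \<and>
      (Suc (inv \<sigma> u) = inv \<sigma> v \<longleftrightarrow> Suc (inv \<tau> u) = inv \<tau> v))" if "i \<le> Suc n" for i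
    using that
  proof (induction i)
    case (Suc i)
    show ?case
    \<comment> \<open>The value 0 carries no label, but it is alone at this stage.\<close>
    proof (cases "i = 0")
      case False
      then have i: "i \<in> {1..n}" using Suc.prems by simp
      have ord: "inv \<sigma> u < inv \<sigma> v \<longleftrightarrow> inv \<tau> u < inv \<tau> v" if "u < i" "v < i" for u v
        using Suc that by simp
      have adj: "Suc (inv \<sigma> u) = inv \<sigma> v \<longleftrightarrow> Suc (inv \<tau> u) = inv \<tau> v" if "u < i" "v < i" for u v
        using Suc that by simp
      have lab': "pat31_2 i \<sigma> = pat31_2 i \<tau>" "i < \<sigma> (inv \<sigma> i - 1) \<longleftrightarrow> i < \<tau> (inv \<tau> i - 1)"
          "\<sigma> (Suc (inv \<sigma> i)) < i \<longleftrightarrow> \<tau> (Suc (inv \<tau> i)) < i"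
        using lab[OF i] by (auto simp: lin_label_def)
      have bs: "block_starts \<sigma> i = block_starts \<tau> i"
        unfolding block_starts_def using adj by blast
      have ordi: "inv \<sigma> v < inv \<sigma> i \<longleftrightarrow> inv \<tau> v < inv \<tau> i" if "v < i" for v
      proof -
        have "inv \<sigma> b \<le> inv \<sigma> v \<longleftrightarrow> inv \<tau> b \<le> inv \<tau> v" if "b \<in> block_starts \<tau> i" for b
          using ord[OF \<open>v < i\<close>, of b] that by (auto simp: block_starts_def)
        then have "{b \<in> block_starts \<sigma> i. inv \<sigma> b \<le> inv \<sigma> v} = {b \<in> block_starts \<tau> i. inv \<tau> b \<le> inv \<tau> v}"
          unfolding bs by blast
        then show ?thesis
          unfolding precedes_iff[OF \<sigma> i that] precedes_iff[OF \<tau> i that] lab'(1) by simp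
      qed
      have ordi': "inv \<sigma> i < inv \<sigma> v \<longleftrightarrow> inv \<tau> i < inv \<tau> v" if "v < i" for v
      proof -
        have "inv \<sigma> i \<noteq> inv \<sigma> v" using perm_inv_simps(1)[OF \<sigma>] that by (metis less_irrefl)
        moreover have "inv \<tau> i \<noteq> inv \<tau> v" using perm_inv_simps(1)[OF \<tau>] that by (metis less_irrefl)
        ultimately show ?thesis using ordi[OF that] by auto
      qed
      have adji: "Suc (inv \<sigma> u) = inv \<sigma> i \<longleftrightarrow> Suc (inv \<tau> u) = inv \<tau> i" if "u < i" for u
        unfolding predecessor_iff[OF \<sigma> i that] predecessor_iff[OF \<tau> i that]
        using lab'(2) ordi ord that by blast
      have adji': "Suc (inv \<sigma> i) = inv \<sigma> v \<longleftrightarrow> Suc (inv \<tau> i) = inv \<tau> v" if "v < i" for v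
        unfolding successor_iff[OF \<sigma> that] successor_iff[OF \<tau> that]
        using lab'(3) ordi' ord that by blast
      show ?thesis
        using ord adj ordi ordi' adji adji' by (auto simp: less_Suc_eq)
    qed simp
  qed simp
  have "inv \<sigma> v = inv \<tau> v" for v
  proof (cases "v \<le> n")
    case True
    then have "{u. u \<le> n \<and> inv \<sigma> u < inv \<sigma> v} = {u. u \<le> n \<and> inv \<tau> u < inv \<tau> v}"
      using same[of "Suc n"] by (auto simp: less_Suc_eq_le)
    then show ?thesis
      using inv_eq_card[OF \<sigma> True] inv_eq_card[OF \<tau> True] by simp
  next
    case False
    then show ?thesis using perm_out(2)[OF \<sigma>, of v] perm_out(2)[OF \<tau>, of v] by simp
  qed
  then have "inv \<sigma> = inv \<tau>" by blast
  then have "inv (inv \<sigma>) = inv (inv \<tau>)" by (rule arg_cong)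
  then show ?thesis
    unfolding inv_inv_eq[OF permutes_bij[OF \<sigma>]] inv_inv_eq[OF permutes_bij[OF \<tau>]] .
qed

lemma linear_sum_histories:
  fixes a b c d :: "nat \<Rightarrow> nat \<Rightarrow> 'r::comm_semiring_1"
  shows "(\<Sum>\<sigma> | \<sigma> permutes {1..n}.
      (\<Prod>i\<in>Val n \<sigma>. a (pat31_2 i \<sigma>) (pat2_31 n i \<sigma>)) *
      (\<Prod>i\<in>Peak n \<sigma>. b (pat31_2 i \<sigma>) (pat2_31 n i \<sigma>)) *
      (\<Prod>i\<in>Ddes n \<sigma>. c (pat31_2 i \<sigma>) (pat2_31 n i \<sigma>)) *
      (\<Prod>i\<in>Dasc n \<sigma> - Fmax n \<sigma>. d (pat31_2 i \<sigma> - 1) (pat2_31 n i \<sigma>)) *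
      (\<Prod>i\<in>Fmax n \<sigma>. e (pat2_31 n i \<sigma>))) =
    (\<Sum>w\<in>histories n 0. weight (laguerre_weight a b c d e) w)" (is "?lhs = _")
proof -
  have "?lhs = (\<Sum>\<sigma> | \<sigma> permutes {1..n}.
      \<Prod>i\<in>{1..n}. laguerre_weight a b c d e (lin_height \<sigma> i) (lin_label \<sigma> i))"
    by (rule sum.cong[OF refl], rule lin_weight[where a = a and b = b and c = c and d = d and e = e], simp)
  also have "\<dots> = (\<Sum>w\<in>histories n 0. weight (laguerre_weight a b c d e) w)"
  proof (rule sum_histories[where hh = lin_height and f = lin_label and W = "laguerre_weight a b c d e" and n = n])
    show "lin_height \<sigma> 1 = 0" "lin_height \<sigma> (Suc n) = 0" if "\<sigma> permutes {1..n}" for \<sigma>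
      using lin_height_1[OF that] lin_height_end[OF that] by auto
    show "laguerre_step (lin_height \<sigma> i) (lin_label \<sigma> i) (lin_height \<sigma> (Suc i))"
      if "\<sigma> permutes {1..n}" "i \<in> {1..n}" for \<sigma> i
      using lin_step that by blast
    show "\<sigma> = \<tau>" if "\<sigma> permutes {1..n}" "\<tau> permutes {1..n}"
        "\<And>i. i \<in> {1..n} \<Longrightarrow> lin_label \<sigma> i = lin_label \<tau> i" for \<sigma> \<tau>
      using that by (rule lin_label_inj)
  qed
  finally show ?thesis .
qed

theorem theorem3p1:
  fixes n :: nat
  shows "Qpoly n \<a> \<b> \<c> \<d> \<e> = (\<Sum>\<sigma> | \<sigma> permutes {1..n}.
      (\<Prod>i\<in>Val n \<sigma>. \<a> (pat31_2 i \<sigma>) (pat2_31 n i \<sigma>)) *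
      (\<Prod>i\<in>Peak n \<sigma>. \<b> (pat31_2 i \<sigma>) (pat2_31 n i \<sigma>)) *
      (\<Prod>i\<in>Ddes n \<sigma>. \<c> (pat31_2 i \<sigma>) (pat2_31 n i \<sigma>)) *
      (\<Prod>i\<in>Dasc n \<sigma> - Fmax n \<sigma>. \<d> (pat31_2 i \<sigma> - 1) (pat2_31 n i \<sigma>)) *
      (\<Prod>i\<in>Fmax n \<sigma>. \<e> (pat2_31 n i \<sigma>)))"
  unfolding Qpoly_histories
  by (rule linear_sum_histories[where a = "\<a>" and b = "\<b>" and c = "\<c>" and d = "\<d>" and e = "\<e>", symmetric])

end
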